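(* Let $\omega$ be a real number with $\omega^2+\omega-1=0$. Let $h\ge1$ and let $H(h)$ be the half graph with color classes $\{u_1,\ldots,u_h\}$ and $\{v_1,\ldots,v_h\}$, where $u_i$ is adjacent to $v_j$ if and only if $j\le h-i+1$. Let $(b_1,\ldots,b_{10})=(\omega,-1,0,1,-\omega,-\omega,1,0,-1,\omega)$ and define $x_i=b_s$ whenever $i\equiv s\pmod{10}$, $1\le s\le 10$, for $i=1,\dots,h$. Let $\mathbf{y}$ be the vector on $V(H(h))$ given by $\mathbf{y}(u_i)=\mathbf{y}(v_i)=x_i$ for $i=1,\ldots,h$. Then $\mathbf{y}$ is an eigenvector of the adjacency matrix of $H(h)$ for the eigenvalue $\omega$ if $h\equiv 7\pmod{10}$, and for the eigenvalue $-\omega$ if $h\equiv 2\pmod{10}$.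
   Context: The half graph $H(h)$ is the chain graph with all cells of size one, i.e. the bipartite graph described in the claim; its eigenvalues and eigenvectors are those of its adjacency matrix. *)

theory Defs
  imports
    Complex_Main
    "HOL-Number_Theory.Cong"
    "Graph_Theory.Pair_Digraph"
    "Jordan_Normal_Form.Char_Poly"
begin

datatype hvertex = U nat | V nat

text \<open>
  A finite simple graph is a \<open>pair_graph\<close>: a finite, symmetric, loop-free set of arcs.
\<close>

definition half_graph :: "nat \<Rightarrow> hvertex pair_pre_digraph" where
  "half_graph h =
    \<lparr> pverts = U ` {1..h} \<union> V ` {1..h},
      parcs = {(U i, V j) | i j. i \<in> {1..h} \<and> j \<in> {1..h} \<and> j \<le> h - i + 1} \<union>
              {(V j, U i) | i j. i \<in> {1..h} \<and> j \<in> {1..h} \<and> j \<le> h - i + 1} \<rparr>"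

lemma pair_graph_half_graph: "pair_graph (half_graph h)"
proof
  have "parcs (half_graph h) \<subseteq> pverts (half_graph h) \<times> pverts (half_graph h)"
    by (auto simp: half_graph_def)
  then show "finite (parcs (half_graph h))"
    by (rule finite_subset) (auto simp: half_graph_def)
  show "symmetric (with_proj (half_graph h))"
    by (auto simp: half_graph_def symmetric_def intro!: symI)
qed (auto simp: half_graph_def)

text \<open>
  Matrices and vectors indexed by the vertices of a graph are represented with respect to
  an enumeration \<open>vs\<close> of the vertex set.
\<close>

definition adjacency_mat :: "'v pair_pre_digraph \<Rightarrow> 'v list \<Rightarrow> real mat" where
  "adjacency_mat G vs =
    mat (length vs) (length vs) (\<lambda>(k, l). if (vs ! k, vs ! l) \<in> parcs G then 1 else 0)"

definition vertex_vec :: "('v \<Rightarrow> real) \<Rightarrow> 'v list \<Rightarrow> real vec" where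
  "vertex_vec f vs = vec (length vs) (\<lambda>k. f (vs ! k))"

definition b_seq :: "real \<Rightarrow> nat \<Rightarrow> real" where
  "b_seq \<omega> s = [\<omega>, -1, 0, 1, -\<omega>, -\<omega>, 1, 0, -1, \<omega>] ! (s - 1)"

definition x_seq :: "real \<Rightarrow> nat \<Rightarrow> real" where
  "x_seq \<omega> i = b_seq \<omega> (THE s. s \<in> {1..10} \<and> [i = s] (mod 10))"

lemma x_seq_eq:
  assumes "s \<in> {1..10}" "[i = s] (mod 10)"
  shows "x_seq \<omega> i = b_seq \<omega> s"
proof -
  have "(THE s. s \<in> {1..10} \<and> [i = s] (mod 10)) = s"
  proof (rule the_equality)
    fix t assume t: "t \<in> {1..10} \<and> [i = t] (mod 10)"
    with assms have "t mod 10 = s mod 10" by (simp add: cong_def)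
    moreover have "t = 10 \<or> t < 10" "s = 10 \<or> s < 10" using t assms by auto
    ultimately show "t = s" using t assms by auto
  qed (use assms in auto)
  then show ?thesis by (simp add: x_seq_def)
qed

fun y_fun :: "real \<Rightarrow> hvertex \<Rightarrow> real" where
  "y_fun \<omega> (U i) = x_seq \<omega> i"
| "y_fun \<omega> (V i) = x_seq \<omega> i"

end

theory Submission
  imports Defs
begin

text \<open>
  At a vertex \<open>u\<^sub>i\<close> or \<open>v\<^sub>i\<close> the eigenvalue equation says that the partial sum
  \<open>x\<^sub>1 + \<dots> + x\<^bsub>h - i + 1\<^esub>\<close> is \<open>\<plusminus>\<omega> x\<^sub>i\<close>. One period of the
  sequence sums to zero, so the partial sums are themselves periodic modulo 10, and the equation
  reduces to the ten residues of \<open>i\<close>, where it follows from \<open>\<omega>\<^sup>2 = 1 - \<omega>\<close>.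
\<close>

text \<open>Removes the enumeration \<open>vs\<close> from the problem: entry \<open>k\<close> of
  the matrix-vector product is the sum of \<open>f\<close> over the neighbours of
  \<open>vs ! k\<close>. The vertex \<open>w\<close> certifies that the vector is nonzero.\<close>

lemma adjacency_mat_eigenvectorI:
  assumes "distinct vs" "set vs = pverts G"
    and "w \<in> pverts G" "f w \<noteq> 0"
    and eq: "\<And>v. v \<in> pverts G \<Longrightarrow> (\<Sum>u | u \<in> pverts G \<and> (v, u) \<in> parcs G. f u) = c * f v"
  shows "eigenvector (adjacency_mat G vs) (vertex_vec f vs) c"
proof -
  let ?A = "adjacency_mat G vs" and ?f = "vertex_vec f vs"
  have dim: "dim_row ?A = length vs" "dim_vec ?f = length vs"
    by (auto simp: adjacency_mat_def vertex_vec_def)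
  have nth: "?f $ k = f (vs ! k)" if "k < length vs" for k
    using that by (simp add: vertex_vec_def)
  obtain k where "k < length vs" "vs ! k = w"
    using assms(2,3) by (metis in_set_conv_nth)
  then have nonzero: "?f \<noteq> 0\<^sub>v (length vs)"
    using nth[of k] assms(4) by auto
  have "?A *\<^sub>v ?f = c \<cdot>\<^sub>v ?f"
  proof (rule eq_vecI)
    fix k assume "k < dim_vec (c \<cdot>\<^sub>v ?f)"
    then have k: "k < length vs" by (simp add: dim)
    have "(?A *\<^sub>v ?f) $ k =
        (\<Sum>l = 0..<length vs. (if (vs ! k, vs ! l) \<in> parcs G then 1 else 0) * f (vs ! l))"
      using k by (simp add: adjacency_mat_def vertex_vec_def scalar_prod_def)
    also have "\<dots> = (\<Sum>l = 0..<length vs. if (vs ! k, vs ! l) \<in> parcs G then f (vs ! l) else 0)"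
      by (intro sum.cong) auto
    \<comment> \<open>Distinctness of \<open>vs\<close> makes \<open>nth\<close> a bijection from
      the indices to the vertices.\<close>
    also have "\<dots> = (\<Sum>u\<in>set vs. if (vs ! k, u) \<in> parcs G then f u else 0)"
      by (rule sum.reindex_bij_betw) (simp add: bij_betw_nth assms(1) atLeast0LessThan)
    also have "\<dots> = (\<Sum>u | u \<in> pverts G \<and> (vs ! k, u) \<in> parcs G. f u)"
      by (simp add: assms(2)[symmetric] sum.inter_filter)
    also have "\<dots> = c * f (vs ! k)"
      using k assms(2) by (intro eq) (metis nth_mem)
    finally show "(?A *\<^sub>v ?f) $ k = (c \<cdot>\<^sub>v ?f) $ k"
      using k by (simp add: dim nth)
  qed (simp add: dim)
  with nonzero show ?thesis
    by (auto simp: eigenvector_def dim intro: carrier_vecI)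
qed

text \<open>The condition i + j \<le> h + 1 is symmetric in i and j, so both colour classes give the
  same sum. Since i \<ge> 1, the bound h - i + 1 is at most h and the range needs no further
  cut.\<close>

lemma half_graph_neighbour_sum:
  assumes f: "\<And>i. f (U i) = x i" "\<And>i. f (V i) = x i"
    and v: "v = U i \<or> v = V i" and i: "i \<in> {1..h}"
  shows "(\<Sum>w | w \<in> pverts (half_graph h) \<and> (v, w) \<in> parcs (half_graph h). f w) =
    (\<Sum>j = 1..h - i + 1. x j)"
  using v
proof
  assume "v = U i"
  then have "{w. w \<in> pverts (half_graph h) \<and> (v, w) \<in> parcs (half_graph h)} =
      V ` {1..h - i + 1}"
    using i by (auto simp: half_graph_def)
  then show ?thesis
    by (simp add: sum.reindex inj_on_def f)
next
  assume "v = V i"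
  then have "{w. w \<in> pverts (half_graph h) \<and> (v, w) \<in> parcs (half_graph h)} =
      U ` {1..h - i + 1}"
    using i by (auto simp: half_graph_def)
  then show ?thesis
    by (simp add: sum.reindex inj_on_def f)
qed

lemma nat_mod_10_cases:
  fixes n :: nat
  obtains "n mod 10 = 0" | "n mod 10 = 1" | "n mod 10 = 2" | "n mod 10 = 3" | "n mod 10 = 4"
    | "n mod 10 = 5" | "n mod 10 = 6" | "n mod 10 = 7" | "n mod 10 = 8" | "n mod 10 = 9"
proof -
  have "k = 0 \<or> k = 1 \<or> k = 2 \<or> k = 3 \<or> k = 4 \<or> k = 5 \<or> k = 6 \<or> k = 7 \<or> k = 8 \<or> k = 9"
    if "k < 10" for k :: nat
    using that by presburger
  from this[of "n mod 10"] show ?thesis using that by fastforce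
qed

text \<open>Two remainders add up to less than 2n, so there is at most one carry.\<close>

lemma mod_add_mod_cases:
  fixes m i n :: nat
  assumes "n > 0"
  shows "m mod n + i mod n = (m + i) mod n \<or> m mod n + i mod n = (m + i) mod n + n"
proof (cases "m mod n + i mod n < n")
  case True
  then show ?thesis
    by (metis mod_add_eq mod_less)
next
  case False
  have "m mod n < n" "i mod n < n" using assms by simp_all
  then have "m mod n + i mod n - n < n" by linarith
  moreover have "(m + i) mod n = (m mod n + i mod n - n) mod n"
    using False by (metis le_mod_geq mod_add_eq not_less)
  ultimately have "(m + i) mod n = m mod n + i mod n - n" by (metis mod_less)
  with False show ?thesis by linarith
qed

text \<open>The list is \<open>b_seq\<close> rotated by one place: residue 0 stands for s = 10, so
  its last entry moves to the front.\<close>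

lemma x_seq_mod_10:
  "x_seq \<omega> i = [\<omega>, \<omega>, -1, 0, 1, -\<omega>, -\<omega>, 1, 0, -1] ! (i mod 10)"
proof -
  let ?s = "if i mod 10 = 0 then 10 else i mod 10"
  have "?s \<in> {1..10}" "[i = ?s] (mod 10)"
    by (auto simp: cong_def less_imp_le)
  then have "x_seq \<omega> i = b_seq \<omega> ?s"
    by (rule x_seq_eq)
  then show ?thesis
    by (cases i rule: nat_mod_10_cases) (simp_all add: b_seq_def)
qed

text \<open>Induction over a table of partial sums. The vanishing sum of a full period closes the
  step from residue 9 back to residue 0.\<close>

lemma sum_x_seq:
  "(\<Sum>j = 1..m. x_seq \<omega> j) =
    [0, \<omega>, \<omega> - 1, \<omega> - 1, \<omega>, 0, -\<omega>, 1 - \<omega>, 1 - \<omega>, -\<omega>] ! (m mod 10)"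
proof (induction m)
  case (Suc m)
  then show ?case
    by (cases m rule: nat_mod_10_cases) (simp_all add: x_seq_mod_10 mod_Suc)
qed simp

text \<open>Here m plays the role of h - i + 1, so m + i = h + 1. The quadratic relation enters at
  the residues where \<open>x_seq \<omega> i\<close> is \<omega> or -\<omega>; at the others both
  sides already agree.\<close>

lemma sum_x_seq_complement:
  assumes "\<omega>\<^sup>2 + \<omega> - 1 = 0"
  shows "[m + i = 8] (mod 10) \<Longrightarrow> (\<Sum>j = 1..m. x_seq \<omega> j) = \<omega> * x_seq \<omega> i"
    and "[m + i = 3] (mod 10) \<Longrightarrow> (\<Sum>j = 1..m. x_seq \<omega> j) = - \<omega> * x_seq \<omega> i"
proof -
  have \<omega>: "\<omega> * \<omega> = 1 - \<omega>"
    using assms by (simp add: power2_eq_square)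
  show "(\<Sum>j = 1..m. x_seq \<omega> j) = \<omega> * x_seq \<omega> i" if "[m + i = 8] (mod 10)"
  proof -
    have "m mod 10 + i mod 10 = 8 \<or> m mod 10 + i mod 10 = 18"
      using mod_add_mod_cases[of 10 m i] that by (simp add: cong_def)
    \<comment> \<open>This bound selects one of the two sums once \<open>i mod 10\<close> is fixed,
      and keeps the list index in range.\<close>
    moreover have "m mod 10 < 10" by simp
    ultimately show ?thesis
      unfolding sum_x_seq unfolding x_seq_mod_10
      by (cases i rule: nat_mod_10_cases) (auto simp: \<omega>)
  qed
  show "(\<Sum>j = 1..m. x_seq \<omega> j) = - \<omega> * x_seq \<omega> i" if "[m + i = 3] (mod 10)"
  proof -
    have "m mod 10 + i mod 10 = 3 \<or> m mod 10 + i mod 10 = 13"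
      using mod_add_mod_cases[of 10 m i] that by (simp add: cong_def)
    moreover have "m mod 10 < 10" by simp
    ultimately show ?thesis
      unfolding sum_x_seq unfolding x_seq_mod_10
      by (cases i rule: nat_mod_10_cases) (auto simp: \<omega>)
  qed
qed

theorem theorem3p8:
  fixes \<omega> :: real and h :: nat and vs :: "hvertex list"
  assumes "\<omega>\<^sup>2 + \<omega> - 1 = 0"
    and "h \<ge> 1"
    and "distinct vs" and "set vs = pverts (half_graph h)"
  shows "([h = 7] (mod 10) \<longrightarrow>
            eigenvector (adjacency_mat (half_graph h) vs) (vertex_vec (y_fun \<omega>) vs) \<omega>) \<and>
         ([h = 2] (mod 10) \<longrightarrow>
            eigenvector (adjacency_mat (half_graph h) vs) (vertex_vec (y_fun \<omega>) vs) (-\<omega>))"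
proof -
  have eigen: "eigenvector (adjacency_mat (half_graph h) vs) (vertex_vec (y_fun \<omega>) vs) c"
    \<comment> \<open>Phrasing the condition as m + i = h + 1 avoids truncated subtraction in the
      congruences below.\<close>
    if sums: "\<And>m i. m + i = h + 1 \<Longrightarrow> (\<Sum>j = 1..m. x_seq \<omega> j) = c * x_seq \<omega> i" for c
  proof (rule adjacency_mat_eigenvectorI[OF assms(3,4)])
    show "U 1 \<in> pverts (half_graph h)"
      using assms(2) by (simp add: half_graph_def)
    \<comment> \<open>The value is \<omega>, and \<omega> = 0 would turn the quadratic equation into
      -1 = 0.\<close>
    show "y_fun \<omega> (U 1) \<noteq> 0"
      using assms(1) by (auto simp: x_seq_mod_10)
    fix v assume "v \<in> pverts (half_graph h)"
    then obtain i where v: "v = U i \<or> v = V i" and i: "i \<in> {1..h}"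
      by (auto simp: half_graph_def)
    have "(\<Sum>u | u \<in> pverts (half_graph h) \<and> (v, u) \<in> parcs (half_graph h). y_fun \<omega> u) =
        (\<Sum>j = 1..h - i + 1. x_seq \<omega> j)"
      by (rule half_graph_neighbour_sum[OF _ _ v i]) simp_all
    also have "\<dots> = c * x_seq \<omega> i"
      using i by (intro sums) auto
    also have "\<dots> = c * y_fun \<omega> v"
      using v by auto
    finally show "(\<Sum>u | u \<in> pverts (half_graph h) \<and> (v, u) \<in> parcs (half_graph h). y_fun \<omega> u) =
        c * y_fun \<omega> v" .
  qed
  show ?thesis
  proof (intro conjI impI eigen)
    fix m i assume "m + i = h + 1" "[h = 7] (mod 10)"
    then have "[m + i = 8] (mod 10)"
      using cong_add_rcancel_nat[of h 1 7 10] by simp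
    then show "(\<Sum>j = 1..m. x_seq \<omega> j) = \<omega> * x_seq \<omega> i"
      by (rule sum_x_seq_complement(1)[OF assms(1)])
  next
    fix m i assume "m + i = h + 1" "[h = 2] (mod 10)"
    then have "[m + i = 3] (mod 10)"
      using cong_add_rcancel_nat[of h 1 2 10] by simp
    then show "(\<Sum>j = 1..m. x_seq \<omega> j) = - \<omega> * x_seq \<omega> i"
      by (rule sum_x_seq_complement(2)[OF assms(1)])
  qed
qed

end
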